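(* Let $H$ be a graph with vertex set $\{v_1,\ldots,v_n\}$. For $1\le i\le n$, let $G_i$ be a graph of order $n_i$ with $p(G_i;1)=n_i$, and let $u_i$ be any vertex of $G_i$, except that if $G_i$ is a path then $u_i$ is not an endpoint of that path. Let $G$ be the graph obtained from $H$ and disjoint copies of $G_1,\ldots,G_n$ by identifying $u_i$ with $v_i$ for each $1\le i\le n$. Then $$\mathcal{P}(G;x)=\prod_{i=1}^n\big((x+1)^{n_i}-1\big).$$
   Context: Graphs are finite and simple with nonempty vertex set. An endpoint of the path $P_m$ is a vertex of degree 1 if $m>1$, and the unique (degree 0) vertex if $m=1$. For $S\subseteq V(G)$, $S$ is a power dominating set if, after coloring $S$, coloring every neighbor of a vertex of $S$, and then repeatedly applying the forcing rule (a colored vertex with exactly one uncolored neighbor colors that neighbor) until no changes occur, all vertices are colored. $p(G;i)$ is the number of power dominating sets of size $i$, and $\mathcal{P}(G;x)=\sum_{i\ge 1} p(G;i)x^i$. *)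

theory Defs
  imports "Graph_Theory.Graph_Theory" "HOL-Computational_Algebra.Polynomial"
begin

text \<open>
  A finite simple graph is a \<open>pair_graph\<close>: its arc set is a finite, symmetric, irreflexive
  relation on a finite vertex set, an undirected edge being the two arcs \<open>(v, w)\<close> and \<open>(w, v)\<close>.
  The locale allows an empty vertex set, which \<open>simple_graph\<close> excludes.
\<close>

definition simple_graph :: "'a pair_pre_digraph \<Rightarrow> bool" where
  "simple_graph G \<longleftrightarrow> pair_graph G \<and> pverts G \<noteq> {}"

definition nbrs :: "'a pair_pre_digraph \<Rightarrow> 'a \<Rightarrow> 'a set" where
  "nbrs G v = {w. (v, w) \<in> parcs G}"

definition degree_of :: "'a pair_pre_digraph \<Rightarrow> 'a \<Rightarrow> nat" where
  "degree_of G v = card (nbrs G v)"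

text \<open>
  \<open>digraph_iso\<close> is not used for \<open>graph_iso\<close>: it requires an equality of records in which the
  head and tail maps have to agree even outside the arc set.
\<close>

definition graph_iso :: "'a pair_pre_digraph \<Rightarrow> 'b pair_pre_digraph \<Rightarrow> bool" where
  "graph_iso G H \<longleftrightarrow> (\<exists>f. bij_betw f (pverts G) (pverts H) \<and>
     (\<forall>x\<in>pverts G. \<forall>y\<in>pverts G. (x, y) \<in> parcs G \<longleftrightarrow> (f x, f y) \<in> parcs H))"

definition path_graph :: "nat \<Rightarrow> nat pair_pre_digraph" where
  "path_graph m = \<lparr> pverts = {1..m},
     parcs = {(i, j). i \<in> {1..m} \<and> j \<in> {1..m} \<and> (j = i + 1 \<or> i = j + 1)} \<rparr>"

definition is_path :: "'a pair_pre_digraph \<Rightarrow> bool" where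
  "is_path G \<longleftrightarrow> (\<exists>m\<ge>1. graph_iso G (path_graph m))"

definition path_endpoint :: "'a pair_pre_digraph \<Rightarrow> 'a \<Rightarrow> bool" where
  "path_endpoint G u \<longleftrightarrow> u \<in> pverts G \<and> (card (pverts G) > 1 \<longrightarrow> degree_of G u = 1)"


definition dominate :: "'a pair_pre_digraph \<Rightarrow> 'a set \<Rightarrow> 'a set" where
  "dominate G S = S \<union> (\<Union>v\<in>S. nbrs G v)"

definition force_step :: "'a pair_pre_digraph \<Rightarrow> 'a set \<Rightarrow> 'a set" where
  "force_step G C = C \<union> {w. \<exists>v\<in>C. nbrs G v - C = {w}}"

definition final_coloring :: "'a pair_pre_digraph \<Rightarrow> 'a set \<Rightarrow> 'a set" where
  "final_coloring G S = (\<Union>k. (force_step G ^^ k) (dominate G S))"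

definition power_dominating :: "'a pair_pre_digraph \<Rightarrow> 'a set \<Rightarrow> bool" where
  "power_dominating G S \<longleftrightarrow> S \<subseteq> pverts G \<and> final_coloring G S = pverts G"

definition num_pds :: "'a pair_pre_digraph \<Rightarrow> nat \<Rightarrow> nat" where
  "num_pds G i = card {S. power_dominating G S \<and> card S = i}"

text \<open>The terms of index larger than the order of the graph vanish.\<close>

definition pd_poly :: "'a pair_pre_digraph \<Rightarrow> int poly" where
  "pd_poly G = (\<Sum>i = 1..card (pverts G). monom (int (num_pds G i)) i)"


definition disjoint_copies ::
  "'a pair_pre_digraph \<Rightarrow> nat \<Rightarrow> (nat \<Rightarrow> 'b pair_pre_digraph) \<Rightarrow> ('a + nat \<times> 'b) pair_pre_digraph" where
  "disjoint_copies H n Gs =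
     \<lparr> pverts = Inl ` pverts H \<union> (\<Union>i\<in>{1..n}. (\<lambda>x. Inr (i, x)) ` pverts (Gs i)),
       parcs = map_prod Inl Inl ` parcs H \<union>
         (\<Union>i\<in>{1..n}. map_prod (\<lambda>x. Inr (i, x)) (\<lambda>x. Inr (i, x)) ` parcs (Gs i)) \<rparr>"

definition image_graph :: "('a \<Rightarrow> 'b) \<Rightarrow> 'a pair_pre_digraph \<Rightarrow> 'b pair_pre_digraph" where
  "image_graph q G = \<lparr> pverts = q ` pverts G, parcs = map_prod q q ` parcs G \<rparr>"

text \<open>
  For distinct \<open>v i\<close> the fibres of \<open>identify v u\<close> are the pairs \<open>{Inl (v i), Inr (i, u i)}\<close> and
  singletons, so the image graph is the quotient that identifies \<open>u i\<close> with \<open>v i\<close>; \<open>Inl (v i)\<close>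
  represents the merged vertex.
\<close>

definition identify :: "(nat \<Rightarrow> 'a) \<Rightarrow> (nat \<Rightarrow> 'b) \<Rightarrow> 'a + nat \<times> 'b \<Rightarrow> 'a + nat \<times> 'b" where
  "identify v u z = (case z of
     Inl a \<Rightarrow> Inl a
   | Inr (i, x) \<Rightarrow> if x = u i then Inl (v i) else Inr (i, x))"

definition attach ::
  "'a pair_pre_digraph \<Rightarrow> nat \<Rightarrow> (nat \<Rightarrow> 'a) \<Rightarrow> (nat \<Rightarrow> 'b pair_pre_digraph) \<Rightarrow> (nat \<Rightarrow> 'b) \<Rightarrow>
   ('a + nat \<times> 'b) pair_pre_digraph" where
  "attach H n v Gs u = image_graph (identify v u) (disjoint_copies H n Gs)"

lemma pair_graph_iff:
  "pair_graph G \<longleftrightarrow> finite (pverts G) \<and> parcs G \<subseteq> pverts G \<times> pverts G \<and> sym (parcs G) \<and>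
     (\<forall>x. (x, x) \<notin> parcs G)"
proof
  assume "pair_graph G"
  then interpret pair_graph G .
  show "finite (pverts G) \<and> parcs G \<subseteq> pverts G \<times> pverts G \<and> sym (parcs G) \<and>
     (\<forall>x. (x, x) \<notin> parcs G)"
    using pair_finite_verts pair_sym_arcs pair_no_loops arc_fst_in_verts arc_snd_in_verts
    by (force simp: symmetric_def)
next
  assume A: "finite (pverts G) \<and> parcs G \<subseteq> pverts G \<times> pverts G \<and> sym (parcs G) \<and>
     (\<forall>x. (x, x) \<notin> parcs G)"
  then have "finite (parcs G)"
    by (meson finite_SigmaI finite_subset)
  with A show "pair_graph G"
    by unfold_locales (auto simp: symmetric_def)
qed

lemma simple_graph_attach:
  assumes "simple_graph H" and "bij_betw v {1..n} (pverts H)"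
    and "\<And>i. i \<in> {1..n} \<Longrightarrow> simple_graph (Gs i)"
  shows "simple_graph (attach H n v Gs u)"
proof -
  let ?G = "attach H n v Gs u" and ?D = "disjoint_copies H n Gs"
  have H: "pair_graph H" "pverts H \<noteq> {}" and Gs: "\<And>i. i \<in> {1..n} \<Longrightarrow> pair_graph (Gs i)"
    using assms by (auto simp: simple_graph_def)
  have H': "finite (pverts H)" "parcs H \<subseteq> pverts H \<times> pverts H" "sym (parcs H)"
      "\<And>x. (x, x) \<notin> parcs H"
    using H(1) by (auto simp: pair_graph_iff)
  have Gs': "finite (pverts (Gs i))" "parcs (Gs i) \<subseteq> pverts (Gs i) \<times> pverts (Gs i)"
      "sym (parcs (Gs i))" "\<And>x. (x, x) \<notin> parcs (Gs i)" if "i \<in> {1..n}" for i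
    using Gs[OF that] by (auto simp: pair_graph_iff)
  have arc: "z \<in> pverts ?D \<and> w \<in> pverts ?D \<and> (w, z) \<in> parcs ?D \<and> identify v u z \<noteq> identify v u w"
    if "(z, w) \<in> parcs ?D" for z w
  proof -
    from that consider a b where "z = Inl a" "w = Inl b" "(a, b) \<in> parcs H"
      | i a b where "i \<in> {1..n}" "z = Inr (i, a)" "w = Inr (i, b)" "(a, b) \<in> parcs (Gs i)"
      unfolding disjoint_copies_def by auto
    then show ?thesis
    proof cases
      case 1
      then have "a \<in> pverts H" "b \<in> pverts H" "(b, a) \<in> parcs H" "a \<noteq> b"
        using H' by (auto dest: symD)
      with 1 show ?thesis
        by (simp add: disjoint_copies_def identify_def rev_image_eqI)
    next
      case 2
      then have "a \<in> pverts (Gs i)" "b \<in> pverts (Gs i)" "(b, a) \<in> parcs (Gs i)" "a \<noteq> b"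
        using Gs'[of i] by (auto dest: symD)
      then have m: "(w, z) \<in> map_prod (\<lambda>x. Inr (i, x)) (\<lambda>x. Inr (i, x)) ` parcs (Gs i)"
          "z \<in> (\<lambda>x. Inr (i, x)) ` pverts (Gs i)" "w \<in> (\<lambda>x. Inr (i, x)) ` pverts (Gs i)"
          and ne: "identify v u z \<noteq> identify v u w"
        using 2 by (auto simp: identify_def intro: rev_image_eqI)
      have "z \<in> pverts ?D" "w \<in> pverts ?D" "(w, z) \<in> parcs ?D"
        unfolding disjoint_copies_def pair_pre_digraph.simps
        by (rule UnI2, rule UN_I[OF 2(1)], rule m)+
      with ne show ?thesis by blast
    qed
  qed
  have "finite (pverts ?G)"
    using H'(1) Gs'(1) by (simp add: attach_def image_graph_def disjoint_copies_def)
  moreover have "x \<in> pverts ?G \<and> y \<in> pverts ?G \<and> (y, x) \<in> parcs ?G \<and> x \<noteq> y"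
    if "(x, y) \<in> parcs ?G" for x y
  proof -
    from that obtain z w where zw: "(z, w) \<in> parcs ?D" "x = identify v u z" "y = identify v u w"
      by (auto simp: attach_def image_graph_def)
    moreover from arc[OF zw(1)] zw(2,3)
    have "(y, x) \<in> map_prod (identify v u) (identify v u) ` parcs ?D"
      by (intro rev_image_eqI[of "(w, z)"]) auto
    ultimately show ?thesis
      using arc[OF zw(1)] by (simp add: attach_def image_graph_def)
  qed
  ultimately have "pair_graph ?G"
    unfolding pair_graph_iff sym_def subset_eq by (metis mem_Sigma_iff prod.collapse)
  then show ?thesis
    using H by (auto simp: simple_graph_def attach_def image_graph_def disjoint_copies_def)
qed

end

theory Submission
  imports Defs
begin

text \<open>
  A set \<open>S\<close> of vertices of the composite graph is power dominating iff it meets every copy of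
  every \<open>G\<^sub>i\<close>; summing \<open>x ^ card S\<close> over such \<open>S\<close> gives the product.

  If \<open>S\<close> meets every copy, then the process inside a copy is not disturbed by the rest of the graph
  until \<open>u\<^sub>i\<close> is coloured, so every \<open>u\<^sub>i\<close> gets coloured; from then on all vertices of \<open>H\<close> are coloured
  and the processes in the copies run to the end. Conversely, a graph in which a single
  vertex of degree at most one is power dominating is a path ending in that vertex, so every \<open>u\<^sub>i\<close>
  has at least two neighbours in \<open>G\<^sub>i\<close>; hence if \<open>S\<close> misses the copy of \<open>G\<^sub>i\<close>, then \<open>u\<^sub>i\<close>, the only
  entrance to this copy, can never force.
\<close>

subsection \<open>Sets closed under forcing\<close>

text \<open>Closedness removes the rounds from later arguments: the final colouring is closed when
  neighbourhoods are finite, and it lies in every closed set containing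
  \<open>dominate G S\<close>.\<close>

definition force_closed :: "'a pair_pre_digraph \<Rightarrow> 'a set \<Rightarrow> bool" where
  "force_closed G C \<longleftrightarrow> (\<forall>x\<in>C. \<forall>w. nbrs G x - C \<noteq> {w})"

text \<open>If some \<open>x\<close> in \<open>C\<close> forces a vertex \<open>w\<close> outside
  \<open>D\<close>, then \<open>w\<close> is also its only neighbour outside the larger set
  \<open>D\<close>, which closedness forbids.\<close>

lemma force_step_subset_closed:
  assumes "force_closed G D" "C \<subseteq> D"
  shows "force_step G C \<subseteq> D"
proof
  fix w assume "w \<in> force_step G C"
  then consider "w \<in> C" | x where "x \<in> C" "nbrs G x - C = {w}"
    by (auto simp: force_step_def)
  then show "w \<in> D"
  proof cases
    case 1
    with assms show ?thesis by auto
  next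
    case 2
    then have "nbrs G x - D = {w}" if "w \<notin> D"
      using assms(2) that by blast
    with 2 assms show ?thesis
      unfolding force_closed_def by blast
  qed
qed

lemma final_coloring_subset_closed:
  assumes "force_closed G D" "dominate G S \<subseteq> D"
  shows "final_coloring G S \<subseteq> D"
proof -
  have "(force_step G ^^ k) (dominate G S) \<subseteq> D" for k
    by (induction k) (simp_all add: assms force_step_subset_closed)
  then show ?thesis
    by (auto simp: final_coloring_def)
qed

lemma dominate_subset_final_coloring: "dominate G S \<subseteq> final_coloring G S"
proof -
  have "(force_step G ^^ 0) (dominate G S) \<subseteq> final_coloring G S"
    unfolding final_coloring_def by blast
  then show ?thesis by simp
qed

text \<open>The rounds increase, so a coloured vertex and its finitely many coloured neighbours are
  all coloured at a common round; a single remaining neighbour would be forced in the next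
  one.\<close>

lemma force_closed_final_coloring:
  assumes "\<And>x. finite (nbrs G x)"
  shows "force_closed G (final_coloring G S)"
  unfolding force_closed_def
proof (intro ballI allI notI)
  let ?F = "\<lambda>k. (force_step G ^^ k) (dominate G S)"
  fix x w
  assume x: "x \<in> final_coloring G S" and w: "nbrs G x - final_coloring G S = {w}"
  have "incseq ?F"
    by (rule incseq_SucI) (auto simp: force_step_def)
  then have mono: "?F k \<subseteq> ?F l" if "k \<le> l" for k l
    using that by (simp add: incseq_def)
  have "\<exists>k. A \<subseteq> ?F k" if "finite A" "A \<subseteq> final_coloring G S" for A
    using that
  proof (induction A)
    case empty
    then show ?case by simp
  next
    case (insert a A)
    then obtain k l where "A \<subseteq> ?F k" "a \<in> ?F l"
      by (auto simp: final_coloring_def)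
    then have "insert a A \<subseteq> ?F (max k l)"
      using mono[of k "max k l"] mono[of l "max k l"] by auto
    then show ?case ..
  qed
  from this[of "insert x (nbrs G x - {w})"] assms x w
  obtain k where k: "insert x (nbrs G x - {w}) \<subseteq> ?F k" by blast
  have Fk: "?F l \<subseteq> final_coloring G S" for l
    unfolding final_coloring_def by blast
  have "nbrs G x - ?F k = {w}"
    using k w Fk[of k] by blast
  then have "w \<in> ?F (Suc k)"
    using k by (auto simp: force_step_def)
  with Fk[of "Suc k"] w show False by blast
qed

lemma finite_nbrs: "simple_graph G \<Longrightarrow> finite (nbrs G x)"
  unfolding simple_graph_def pair_graph_iff nbrs_def
  by (rule finite_subset[of _ "pverts G"]) auto

lemma final_coloring_subset_pverts:
  assumes "simple_graph G" "S \<subseteq> pverts G"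
  shows "final_coloring G S \<subseteq> pverts G"
proof (rule final_coloring_subset_closed)
  have "nbrs G x \<subseteq> pverts G" for x
    using assms(1) by (auto simp: simple_graph_def pair_graph_iff nbrs_def)
  then show "force_closed G (pverts G)" "dominate G S \<subseteq> pverts G"
    using assms(2) by (auto simp: force_closed_def dominate_def)
qed

subsection \<open>Graphs power dominated by a leaf\<close>

text \<open>By the last condition, \<open>f m\<close> is the only vertex of \<open>C\<close> that can still force.\<close>

definition initial_path :: "'a pair_pre_digraph \<Rightarrow> nat \<Rightarrow> (nat \<Rightarrow> 'a) \<Rightarrow> 'a set \<Rightarrow> bool" where
  "initial_path G m f C \<longleftrightarrow> m \<ge> 1 \<and> bij_betw f {1..m} C \<and>
     (\<forall>i\<in>{1..m}. \<forall>j\<in>{1..m}. (f i, f j) \<in> parcs G \<longleftrightarrow> j = i + 1 \<or> i = j + 1) \<and>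
     (\<forall>i\<in>{1..<m}. nbrs G (f i) \<subseteq> C)"

text \<open>Only \<open>f m\<close> can have neighbours outside \<open>C\<close>, so it is
  \<open>f m\<close> that forces \<open>w\<close>; hence \<open>w\<close> is adjacent to this end
  alone and the path stays induced.\<close>

lemma initial_path_extend:
  assumes "simple_graph G" and ip: "initial_path G m f C" and "x \<in> C" "nbrs G x - C = {w}"
  shows "\<exists>f'. initial_path G (Suc m) f' (insert w C)"
proof -
  let ?f = "f(Suc m := w)"
  have sym: "(b, a) \<in> parcs G" if "(a, b) \<in> parcs G" for a b
    using assms(1) that by (auto simp: simple_graph_def pair_graph_iff dest: symD)
  have irrefl: "(a, a) \<notin> parcs G" for a
    using assms(1) by (auto simp: simple_graph_def pair_graph_iff)
  have m: "m \<ge> 1" and bij: "bij_betw f {1..m} C"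
    and adj: "\<And>i j. i \<in> {1..m} \<Longrightarrow> j \<in> {1..m} \<Longrightarrow>
      (f i, f j) \<in> parcs G \<longleftrightarrow> j = i + 1 \<or> i = j + 1"
    and old: "\<And>i. i \<in> {1..<m} \<Longrightarrow> nbrs G (f i) \<subseteq> C"
    using ip by (auto simp: initial_path_def)
  have w: "w \<notin> C" using assms(4) by blast
  obtain i where i: "i \<in> {1..m}" "x = f i"
    using assms(3) bij by (auto simp: bij_betw_def)
  have "i = m"
  proof (rule ccontr)
    assume "i \<noteq> m"
    with i old[of i] assms(4) show False by auto
  qed
  with i assms(4) have xm: "x = f m" by simp
  have fw: "(f j, w) \<in> parcs G \<longleftrightarrow> j = m" if "j \<in> {1..m}" for j
  proof (cases "j = m")
    case True
    then show ?thesis using assms(4) xm by (auto simp: nbrs_def)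
  next
    case False
    then show ?thesis using old[of j] that w by (auto simp: nbrs_def)
  qed
  have wf: "(w, f j) \<in> parcs G \<longleftrightarrow> j = m" if "j \<in> {1..m}" for j
    using fw[OF that] sym by blast
  have "bij_betw ?f {1..m} C"
    using bij by (subst bij_betw_cong[of _ _ f]) auto
  then have "bij_betw ?f ({1..m} \<union> {Suc m}) (C \<union> {w})"
    by (rule bij_betw_combine) (use w in auto)
  then have "bij_betw ?f {1..Suc m} (insert w C)"
    by (simp add: atLeastAtMostSuc_conv)
  moreover have "(?f i, ?f j) \<in> parcs G \<longleftrightarrow> j = i + 1 \<or> i = j + 1"
    if "i \<in> {1..Suc m}" "j \<in> {1..Suc m}" for i j
    using that adj[of i j] fw[of i] wf[of j] irrefl[of w]
    by (cases "i = Suc m"; cases "j = Suc m") auto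
  \<comment> \<open>\<open>f m\<close> becomes an interior vertex: \<open>w\<close> was its only
    neighbour outside \<open>C\<close>.\<close>
  moreover have "nbrs G (?f i) \<subseteq> insert w C" if "i \<in> {1..<Suc m}" for i
    using that old[of i] assms(4) xm by (cases "i = m") auto
  ultimately have "initial_path G (Suc m) ?f (insert w C)"
    by (auto simp: initial_path_def)
  then show ?thesis by (rule exI[of _ ?f])
qed

text \<open>Starting from \<open>{u}\<close>, each force lengthens an induced path. The position of
  \<open>u\<close> on it is not tracked, since being an endpoint is read off the degree.\<close>

lemma leaf_power_dominating_is_path:
  assumes G: "simple_graph G" and u: "u \<in> pverts G" and pd: "power_dominating G {u}"
    and deg: "degree_of G u \<le> 1"
  shows "is_path G" "path_endpoint G u"
proof -
  \<comment> \<open>A maximal member of this finite family is closed, because a force would produce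
    a larger member.\<close>
  define K where "K = {C. C \<subseteq> pverts G \<and> u \<in> C \<and> (\<exists>m f. initial_path G m f C)}"
  have fin: "finite (pverts G)" and sub: "parcs G \<subseteq> pverts G \<times> pverts G"
    and irrefl: "\<And>x. (x, x) \<notin> parcs G"
    using G by (auto simp: simple_graph_def pair_graph_iff)
  have "initial_path G 1 (\<lambda>_. u) {u}"
    using irrefl by (auto simp: initial_path_def bij_betw_def)
  then have "{u} \<in> K"
    using u by (auto simp: K_def)
  moreover have "finite K"
    using fin by (auto simp: K_def intro: finite_subset[of _ "Pow (pverts G)"])
  ultimately obtain C where C: "C \<in> K" and max: "\<And>D. D \<in> K \<Longrightarrow> C \<subseteq> D \<Longrightarrow> C = D"
    using finite_has_maximal[of K] by (metis empty_iff)
  obtain m f where ip: "initial_path G m f C"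
    using C by (auto simp: K_def)
  have closed: "force_closed G C"
    unfolding force_closed_def
  proof (intro ballI allI notI)
    fix x w assume x: "x \<in> C" and w: "nbrs G x - C = {w}"
    then have "(x, w) \<in> parcs G" by (auto simp: nbrs_def)
    then have "w \<in> pverts G" using sub by auto
    with initial_path_extend[OF G ip x w] C have "insert w C \<in> K"
      by (auto simp: K_def)
    from max[OF this] w show False by blast
  qed
  \<comment> \<open>With at most one neighbour, domination by \<open>u\<close> is already a round of
    forcing from \<open>{u}\<close>, so any closed set containing \<open>u\<close> contains
    it.\<close>
  have "dominate G {u} \<subseteq> force_step G {u}"
  proof -
    have "u \<notin> nbrs G u" using irrefl by (simp add: nbrs_def)
    then have "nbrs G u - {u} = nbrs G u" by simp
    moreover have "nbrs G u = {w}" if "w \<in> nbrs G u" for w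
      using that deg card_le_Suc0_iff_eq[OF finite_nbrs[OF G, of u]]
      by (auto simp: degree_of_def)
    ultimately have "nbrs G u \<subseteq> {w. nbrs G u - {u} = {w}}"
      by (intro subsetI CollectI) (rule trans)
    then show ?thesis
      unfolding dominate_def force_step_def by blast
  qed
  also have "\<dots> \<subseteq> C"
    by (rule force_step_subset_closed[OF closed]) (use C in \<open>auto simp: K_def\<close>)
  finally have "pverts G \<subseteq> C"
    using final_coloring_subset_closed[OF closed] pd by (auto simp: power_dominating_def)
  with C have Cv: "C = pverts G" by (auto simp: K_def)
  have m: "m \<ge> 1" and bij: "bij_betw f {1..m} (pverts G)"
    and adj: "\<And>i j. i \<in> {1..m} \<Longrightarrow> j \<in> {1..m} \<Longrightarrow>
      (f i, f j) \<in> parcs G \<longleftrightarrow> j = i + 1 \<or> i = j + 1"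
    using ip Cv by (auto simp: initial_path_def)
  let ?g = "inv_into {1..m} f"
  have g: "bij_betw ?g (pverts G) {1..m}"
    by (rule bij_betw_inv_into[OF bij])
  have fg: "f (?g x) = x" "?g x \<in> {1..m}" if "x \<in> pverts G" for x
    using that bij bij_betw_inv_into_right bij_betwE[OF g] by metis+
  have "(x, y) \<in> parcs G \<longleftrightarrow> (?g x, ?g y) \<in> parcs (path_graph m)"
    if "x \<in> pverts G" "y \<in> pverts G" for x y
    using adj[of "?g x" "?g y"] fg[OF that(1)] fg[OF that(2)] by (simp add: path_graph_def)
  then have "graph_iso G (path_graph m)"
    using g by (auto simp: graph_iso_def path_graph_def)
  then show "is_path G"
    using m by (auto simp: is_path_def)
  \<comment> \<open>An isolated \<open>u\<close> would colour nothing but itself.\<close>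
  have "degree_of G u \<noteq> 0" if "card (pverts G) > 1"
  proof
    assume "degree_of G u = 0"
    then have "nbrs G u = {}"
      using finite_nbrs[OF G] by (simp add: degree_of_def)
    then have "final_coloring G {u} \<subseteq> {u}"
      by (intro final_coloring_subset_closed) (auto simp: force_closed_def dominate_def)
    then have "pverts G \<subseteq> {u}"
      using pd by (simp add: power_dominating_def)
    then have "card (pverts G) \<le> 1"
      using card_mono[of "{u}"] by fastforce
    with that show False by simp
  qed
  then show "path_endpoint G u"
    using u deg by (auto simp: path_endpoint_def)
qed

text \<open>The power dominating sets of size 1 lie among the singletons of vertices; equal finite
  cardinality makes the two families coincide.\<close>

lemma singleton_power_dominating:
  assumes "simple_graph G" "num_pds G 1 = card (pverts G)" "x \<in> pverts G"
  shows "power_dominating G {x}"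
proof -
  let ?P = "{S. power_dominating G S \<and> card S = 1}" and ?Q = "(\<lambda>x. {x}) ` pverts G"
  have "?P \<subseteq> ?Q"
    by (auto simp: power_dominating_def card_1_singleton_iff)
  moreover have "finite ?Q"
    using assms(1) by (simp add: simple_graph_def pair_graph_iff)
  moreover have "card ?P = card ?Q"
    using assms(2) by (simp add: num_pds_def card_image)
  ultimately have "?P = ?Q"
    using card_subset_eq by blast
  with assms(3) show ?thesis by auto
qed

subsection \<open>Generating functions of families of sets\<close>

text \<open>Group the sets by size; size 0 does not occur because \<open>P {}\<close> fails, which
  matches the sum starting at 1.\<close>

lemma sum_power_card_by_size:
  fixes x :: "'b::comm_ring_1"
  assumes "finite V" "\<And>S. P S \<Longrightarrow> S \<subseteq> V" "\<not> P {}"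
  shows "(\<Sum>i = 1..card V. of_nat (card {S. P S \<and> card S = i}) * x ^ i) =
    (\<Sum>S | P S. x ^ card S)"
proof -
  have fin: "finite {S. P S}"
    by (rule finite_subset[of _ "Pow V"]) (use assms in auto)
  have "card S \<in> {1..card V}" if "P S" for S
  proof -
    have "S \<subseteq> V" "S \<noteq> {}" using assms that by auto
    then show ?thesis
      using assms(1) by (auto simp: Suc_le_eq card_gt_0_iff card_mono intro: finite_subset)
  qed
  then have "card ` {S. P S} \<subseteq> {1..card V}" by auto
  from sum.group[OF fin _ this, of "\<lambda>S. x ^ card S"]
  show ?thesis by simp
qed

text \<open>\<open>[:0, 1:]\<close> is the indeterminate. The empty set colours nothing while the
  graph has a vertex, so there is no constant term.\<close>

lemma pd_poly_eq_sum:
  assumes "simple_graph G"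
  shows "pd_poly G = (\<Sum>S | power_dominating G S. [:0, 1:] ^ card S)"
proof -
  have "final_coloring G {} = {}"
    using final_coloring_subset_closed[of G "{}" "{}"]
    by (auto simp: force_closed_def dominate_def)
  then have "\<not> power_dominating G {}"
    using assms by (auto simp: power_dominating_def simple_graph_def)
  from sum_power_card_by_size[of "pverts G" "power_dominating G" "[:0, 1:] :: int poly", OF _ _ this]
  show ?thesis
    using assms
    by (simp add: pd_poly_def num_pds_def power_dominating_def simple_graph_def pair_graph_iff
        monom_altdef of_nat_poly)
qed

text \<open>Expand the product of \<open>x + 1\<close> over \<open>V\<close>: a subset records the
  factors from which \<open>x\<close> is taken.\<close>

lemma sum_power_card_Pow:
  fixes x :: "'b::comm_semiring_1"
  assumes "finite V"
  shows "(\<Sum>S\<in>Pow V. x ^ card S) = (x + 1) ^ card V"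
proof -
  have "(\<Prod>a\<in>V. x + 1) = (\<Sum>S\<in>Pow V. (\<Prod>a\<in>S. x) * (\<Prod>a\<in>V - S. 1))"
    by (rule prod_add[OF assms])
  then show ?thesis by simp
qed

text \<open>A set meeting every block amounts to a free choice of a nonempty trace on each block,
  and \<open>x ^ card S\<close> is multiplicative over disjoint unions.\<close>

lemma sum_power_card_transversals:
  fixes x :: "'b::comm_ring_1" and V :: "'i \<Rightarrow> 'a set"
  assumes I: "finite I" and fin: "\<And>i. i \<in> I \<Longrightarrow> finite (V i)"
    and disj: "\<And>i j. i \<in> I \<Longrightarrow> j \<in> I \<Longrightarrow> i \<noteq> j \<Longrightarrow> V i \<inter> V j = {}"
  shows "(\<Sum>S | S \<subseteq> (\<Union>i\<in>I. V i) \<and> (\<forall>i\<in>I. S \<inter> V i \<noteq> {}). x ^ card S) =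
    (\<Prod>i\<in>I. (x + 1) ^ card (V i) - 1)"
proof -
  let ?B = "\<lambda>i. Pow (V i) - {{}}"
  \<comment> \<open>The subtracted 1 is the term \<open>x ^ 0\<close> of the empty subset.\<close>
  have fac: "(x + 1) ^ card (V i) - 1 = (\<Sum>T\<in>?B i. x ^ card T)" if "i \<in> I" for i
    using fin[OF that] by (simp add: sum_power_card_Pow[symmetric] sum_diff1)
  have "(\<Prod>i\<in>I. (x + 1) ^ card (V i) - 1) = (\<Prod>i\<in>I. \<Sum>T\<in>?B i. x ^ card T)"
    by (rule prod.cong) (simp_all add: fac)
  also have "\<dots> = (\<Sum>g\<in>PiE I ?B. \<Prod>i\<in>I. x ^ card (g i))"
    using I fin by (intro prod_sum_PiE) auto
  also have "\<dots> = (\<Sum>S | S \<subseteq> (\<Union>i\<in>I. V i) \<and> (\<forall>i\<in>I. S \<inter> V i \<noteq> {}). x ^ card S)"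
  \<comment> \<open>A family goes to its union, a set to its traces; disjointness of the blocks
    makes these maps mutually inverse.\<close>
  proof (rule sum.reindex_bij_witness[where j = "\<lambda>g. \<Union>i\<in>I. g i" and i = "\<lambda>S. \<lambda>i\<in>I. S \<inter> V i"])
    fix g assume g: "g \<in> PiE I ?B"
    then have sub: "g i \<subseteq> V i" and ne: "g i \<noteq> {}" if "i \<in> I" for i
      using that by (auto dest: PiE_mem)
    have inter: "(\<Union>j\<in>I. g j) \<inter> V i = g i" if "i \<in> I" for i
    proof
      show "g i \<subseteq> (\<Union>j\<in>I. g j) \<inter> V i" using that sub by blast
      show "(\<Union>j\<in>I. g j) \<inter> V i \<subseteq> g i"
      proof
        fix a assume "a \<in> (\<Union>j\<in>I. g j) \<inter> V i"
        then obtain j where j: "j \<in> I" "a \<in> g j" "a \<in> V i" by auto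
        then have "j = i" using sub[of j] disj[of i j] that by auto
        with j show "a \<in> g i" by simp
      qed
    qed
    show "(\<lambda>i\<in>I. (\<Union>i\<in>I. g i) \<inter> V i) = g"
      using g inter by (intro PiE_ext[of _ I "\<lambda>_. UNIV"]) (auto simp: PiE_def)
    show "(\<Union>i\<in>I. g i) \<in> {S. S \<subseteq> (\<Union>i\<in>I. V i) \<and> (\<forall>i\<in>I. S \<inter> V i \<noteq> {})}"
    proof (intro CollectI conjI ballI)
      show "(\<Union>i\<in>I. g i) \<subseteq> (\<Union>i\<in>I. V i)" using sub by blast
    next
      fix i assume "i \<in> I"
      then show "(\<Union>i\<in>I. g i) \<inter> V i \<noteq> {}" using inter[of i] ne[of i] by simp
    qed
    have "card (\<Union>i\<in>I. g i) = (\<Sum>i\<in>I. card (g i))"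
    proof (rule card_UN_disjoint[OF I])
      show "\<forall>i\<in>I. finite (g i)" using fin sub finite_subset by blast
      show "\<forall>i\<in>I. \<forall>j\<in>I. i \<noteq> j \<longrightarrow> g i \<inter> g j = {}"
        using sub disj by blast
    qed
    then show "x ^ card (\<Union>i\<in>I. g i) = (\<Prod>i\<in>I. x ^ card (g i))"
      by (simp add: power_sum)
  qed auto
  finally show ?thesis ..
qed

subsection \<open>The composite graph\<close>

text \<open>The inclusion of the copy followed by \<open>identify\<close>, that is, the embedding of
  \<open>Gs i\<close> in the glued graph.\<close>

definition copy_emb :: "(nat \<Rightarrow> 'a) \<Rightarrow> (nat \<Rightarrow> 'b) \<Rightarrow> nat \<Rightarrow> 'b \<Rightarrow> 'a + nat \<times> 'b" where
  "copy_emb v u i x = (if x = u i then Inl (v i) else Inr (i, x))"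

text \<open>Copies stay disjoint after gluing: injectivity of \<open>v\<close> separates the merged
  vertices, the tag \<open>i\<close> the others.\<close>

lemma copy_emb_eq_iff:
  assumes "inj_on v {1..n}" "i \<in> {1..n}" "j \<in> {1..n}"
  shows "copy_emb v u i x = copy_emb v u j y \<longleftrightarrow> i = j \<and> x = y"
  using assms by (auto simp: copy_emb_def dest: inj_onD)

text \<open>Every vertex of \<open>H\<close> is some \<open>v i\<close>, hence the image of
  \<open>u i\<close>, so the copies alone cover the glued graph.\<close>

lemma pverts_attach:
  assumes "bij_betw v {1..n} (pverts H)" "\<And>i. i \<in> {1..n} \<Longrightarrow> u i \<in> pverts (Gs i)"
  shows "pverts (attach H n v Gs u) = (\<Union>i\<in>{1..n}. copy_emb v u i ` pverts (Gs i))"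
proof -
  have [simp]: "identify v u (Inr (i, x)) = copy_emb v u i x" "identify v u (Inl a) = Inl a"
    for i x a
    by (simp_all add: identify_def copy_emb_def)
  have eq: "pverts (attach H n v Gs u) =
      Inl ` pverts H \<union> (\<Union>i\<in>{1..n}. copy_emb v u i ` pverts (Gs i))"
    unfolding attach_def image_graph_def disjoint_copies_def
    by (simp add: image_Un image_UN image_image)
  have "Inl a \<in> (\<Union>i\<in>{1..n}. copy_emb v u i ` pverts (Gs i))" if a: "a \<in> pverts H" for a
  proof -
    obtain i where i: "i \<in> {1..n}" "a = v i"
      using assms(1) a by (metis bij_betw_imp_surj_on imageE)
    have "Inl a = copy_emb v u i (u i)" by (simp add: copy_emb_def i)
    then have "Inl a \<in> copy_emb v u i ` pverts (Gs i)"
      by (rule image_eqI) (rule assms(2)[OF i(1)])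
    then show ?thesis by (rule UN_I[OF i(1)])
  qed
  then have "Inl ` pverts H \<subseteq> (\<Union>i\<in>{1..n}. copy_emb v u i ` pverts (Gs i))"
    by (rule image_subsetI)
  then show ?thesis unfolding eq by (rule Un_absorb1)
qed

text \<open>Arcs of \<open>H\<close> join merged vertices only, and arcs of other copies do not
  start in copy \<open>i\<close>.\<close>

lemma nbrs_attach:
  fixes H :: "'a pair_pre_digraph" and Gs :: "nat \<Rightarrow> 'b pair_pre_digraph"
  assumes "bij_betw v {1..n} (pverts H)" "i \<in> {1..n}"
  shows "nbrs (attach H n v Gs u) (copy_emb v u i x) =
    copy_emb v u i ` nbrs (Gs i) x \<union> (if x = u i then Inl ` nbrs H (v i) else {})"
proof -
  have inj: "inj_on v {1..n}" using assms(1) by (simp add: bij_betw_def)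
  have [simp]: "identify v u (Inr (i, x)) = copy_emb v u i x" "identify v u (Inl a) = Inl a"
    for i x a
    by (simp_all add: identify_def copy_emb_def)
  have parcs: "parcs (attach H n v Gs u) = map_prod Inl Inl ` parcs H \<union>
      (\<Union>j\<in>{1..n}. map_prod (copy_emb v u j) (copy_emb v u j) ` parcs (Gs j))"
    unfolding attach_def image_graph_def disjoint_copies_def
    by (simp add: image_Un image_UN image_image map_prod.compositionality comp_def)
  have "(copy_emb v u i x, q) \<in> map_prod Inl Inl ` parcs H \<longleftrightarrow>
      x = u i \<and> q \<in> Inl ` nbrs H (v i)" for q :: "'a + nat \<times> 'b"
    by (auto simp: copy_emb_def nbrs_def)
  moreover have "(copy_emb v u i x, q) \<in> map_prod (copy_emb v u j) (copy_emb v u j) ` parcs (Gs j) \<longleftrightarrow>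
      j = i \<and> q \<in> copy_emb v u i ` nbrs (Gs i) x" if j: "j \<in> {1..n}" for q j
    by (auto simp: nbrs_def copy_emb_eq_iff[OF inj assms(2) j] intro: rev_image_eqI)
  ultimately show ?thesis
    using assms(2) unfolding nbrs_def[of "attach H n v Gs u"] parcs by auto
qed

text \<open>The degree bound serves the forward direction, the power dominating singletons the
  converse.\<close>

lemma power_dominating_attach_iff:
  assumes H: "simple_graph H" and v: "bij_betw v {1..n} (pverts H)"
    and Gs: "\<And>i. i \<in> {1..n} \<Longrightarrow> simple_graph (Gs i)"
    and pd: "\<And>i x. i \<in> {1..n} \<Longrightarrow> x \<in> pverts (Gs i) \<Longrightarrow> power_dominating (Gs i) {x}"
    and u: "\<And>i. i \<in> {1..n} \<Longrightarrow> u i \<in> pverts (Gs i)"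
    and deg: "\<And>i. i \<in> {1..n} \<Longrightarrow> degree_of (Gs i) (u i) \<ge> 2"
    and S: "S \<subseteq> pverts (attach H n v Gs u)"
  shows "power_dominating (attach H n v Gs u) S \<longleftrightarrow>
    (\<forall>i\<in>{1..n}. S \<inter> copy_emb v u i ` pverts (Gs i) \<noteq> {})"
proof -
  let ?G = "attach H n v Gs u" and ?e = "copy_emb v u"
  have inj: "inj_on v {1..n}" using v by (simp add: bij_betw_def)
  note e_eq = copy_emb_eq_iff[OF inj, where u = u]
  note nb = nbrs_attach[OF v, where Gs = Gs and u = u]
  have pv: "pverts ?G = (\<Union>i\<in>{1..n}. ?e i ` pverts (Gs i))"
    by (rule pverts_attach[OF v u])
  have G: "simple_graph ?G"
    by (rule simple_graph_attach[OF H v Gs])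
  have nbGs: "nbrs (Gs i) x \<subseteq> pverts (Gs i)" if "i \<in> {1..n}" for i x
    using Gs[OF that] by (auto simp: simple_graph_def pair_graph_iff nbrs_def)
  have Inl_nbrs: "\<exists>j\<in>{1..n}. q = ?e j (u j)" if q: "q \<in> Inl ` nbrs H a" for q a
  proof -
    obtain b where b: "q = Inl b" "b \<in> pverts H"
      using q H by (auto simp: simple_graph_def pair_graph_iff nbrs_def)
    then obtain j where "j \<in> {1..n}" "b = v j"
      using v by (metis bij_betw_imp_surj_on imageE)
    with b show ?thesis by (auto simp: copy_emb_def)
  qed
  show ?thesis
  proof
    assume L: "power_dominating ?G S"
    show "\<forall>i\<in>{1..n}. S \<inter> ?e i ` pverts (Gs i) \<noteq> {}"
    proof (intro ballI notI)
      fix i assume i: "i \<in> {1..n}" and emp: "S \<inter> ?e i ` pverts (Gs i) = {}"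
      \<comment> \<open>The missed copy without its merged vertex; its complement turns out to be
        closed, so \<open>?N\<close> is never coloured.\<close>
      let ?N = "?e i ` (pverts (Gs i) - {u i})"
      have uN: "?e j (u j) \<notin> ?N" if "j \<in> {1..n}" for j
        using i that e_eq by auto
      \<comment> \<open>Neighbours of a vertex of another copy lie in that copy or are merged
        vertices.\<close>
      have other: "nbrs ?G (?e j x) \<inter> ?N = {}" if j: "j \<in> {1..n}" "j \<noteq> i" for j x
      proof -
        have eN: "?e j y \<notin> ?N" for y
          using i j e_eq by auto
        have "q \<notin> ?N" if "q \<in> nbrs ?G (?e j x)" for q
        proof -
          from that consider y where "q = ?e j y" | "q \<in> Inl ` nbrs H (v j)"
            unfolding nb[OF j(1)] by (auto split: if_splits)
          then show ?thesis
          proof cases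
            case 1
            then show ?thesis using eN by simp
          next
            case 2
            from Inl_nbrs[OF this] show ?thesis using uN by (elim bexE) simp
          qed
        qed
        then show ?thesis by blast
      qed
      have out: "\<exists>j\<in>{1..n}. \<exists>x. j \<noteq> i \<and> p = ?e j x"
        if p: "p \<in> pverts ?G" "p \<notin> ?e i ` pverts (Gs i)" for p
      proof -
        obtain j x where jx: "j \<in> {1..n}" "x \<in> pverts (Gs j)" "p = ?e j x"
          using p(1) unfolding pv by (elim UN_E imageE)
        then have "j \<noteq> i" using p(2) by auto
        with jx show ?thesis by blast
      qed
      have "force_closed ?G (- ?N)"
        unfolding force_closed_def
      proof (intro ballI allI notI)
        fix p w assume p: "p \<in> - ?N" and w: "nbrs ?G p - - ?N = {w}"
        then have w': "nbrs ?G p \<inter> ?N = {w}" by blast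
        then have "(p, w) \<in> parcs ?G" by (auto simp: nbrs_def)
        then have "p \<in> pverts ?G"
          using G by (auto simp: simple_graph_def pair_graph_iff)
        then have "p \<in> ?e i ` pverts (Gs i)"
          using out other w' by (metis empty_iff insertI1)
        with p have p: "p = ?e i (u i)" by blast
        have "u i \<notin> nbrs (Gs i) (u i)"
          using Gs[OF i] by (auto simp: simple_graph_def pair_graph_iff nbrs_def)
        \<comment> \<open>The merged vertex sees at least two vertices of \<open>?N\<close>, so it
          cannot force into it.\<close>
        then have "?e i ` nbrs (Gs i) (u i) \<subseteq> nbrs ?G p \<inter> ?N"
          using nbGs[OF i] p nb[OF i] by auto
        then have "?e i ` nbrs (Gs i) (u i) \<subseteq> {w}" using w' by simp
        then have "card (?e i ` nbrs (Gs i) (u i)) \<le> 1"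
          using card_mono[of "{w}"] by fastforce
        moreover have "inj_on (?e i) (nbrs (Gs i) (u i))"
          using e_eq i by (auto simp: inj_on_def)
        ultimately show False
          using deg[OF i] by (simp add: degree_of_def card_image)
      qed
      moreover have "dominate ?G S \<subseteq> - ?N"
      proof -
        have "p \<notin> ?N \<and> nbrs ?G p \<inter> ?N = {}" if "p \<in> S" for p
        proof -
          have "p \<notin> ?e i ` pverts (Gs i)" using that emp by blast
          then show ?thesis
            using out[of p] other S that by blast
        qed
        then show ?thesis by (auto simp: dominate_def)
      qed
      ultimately have "pverts ?G \<subseteq> - ?N"
        using final_coloring_subset_closed L by (metis power_dominating_def)
      moreover have "?N \<subseteq> pverts ?G"
        using UN_upper[OF i, of "\<lambda>i. ?e i ` pverts (Gs i)"] unfolding pv by blast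
      ultimately have "pverts (Gs i) \<subseteq> {u i}" by blast
      then have "nbrs (Gs i) (u i) \<subseteq> {u i}" using nbGs[OF i] by blast
      then have "degree_of (Gs i) (u i) \<le> 1"
        using card_mono[of "{u i}"] by (fastforce simp: degree_of_def)
      with deg[OF i] show False by simp
    qed
  next
    assume R: "\<forall>i\<in>{1..n}. S \<inter> ?e i ` pverts (Gs i) \<noteq> {}"
    let ?F = "final_coloring ?G S"
    have closed: "force_closed ?G ?F"
      by (rule force_closed_final_coloring[OF finite_nbrs[OF G]])
    have domF: "dominate ?G S \<subseteq> ?F"
      by (rule dominate_subset_final_coloring)
    \<comment> \<open>The two alternatives are the situations in which \<open>H\<close> does not
      disturb the copy: \<open>u i\<close>, its only link to \<open>H\<close>, is uncoloured, or
      every vertex of \<open>H\<close> is coloured.\<close>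
    have whole: "?e i ` pverts (Gs i) \<subseteq> ?F"
      if i: "i \<in> {1..n}" and case': "?e i (u i) \<notin> ?F \<or> (\<forall>j\<in>{1..n}. ?e j (u j) \<in> ?F)" for i
    proof -
      let ?C = "{x. ?e i x \<in> ?F}"
      obtain s where s: "s \<in> pverts (Gs i)" "?e i s \<in> S"
        using R i by blast
      have "force_closed (Gs i) ?C"
        unfolding force_closed_def
      proof (intro ballI allI notI)
        fix x w assume x: "x \<in> ?C" and w: "nbrs (Gs i) x - ?C = {w}"
        \<comment> \<open>Neighbours reached through \<open>H\<close> are already coloured, so the
          uncoloured neighbours of \<open>x\<close> are those inside the copy.\<close>
        have "(if x = u i then Inl ` nbrs H (v i) else {}) \<subseteq> ?F"
        proof (cases "x = u i")
          case True
          then have all: "\<forall>j\<in>{1..n}. ?e j (u j) \<in> ?F" using x case' by simp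
          have "q \<in> ?F" if "q \<in> Inl ` nbrs H (v i)" for q
            using Inl_nbrs[OF that] all by (elim bexE) simp
          then show ?thesis using True by auto
        qed simp
        then have "nbrs ?G (?e i x) - ?F = ?e i ` nbrs (Gs i) x - ?F"
          unfolding nb[OF i] by blast
        also have "\<dots> = ?e i ` (nbrs (Gs i) x - ?C)" by blast
        finally have "nbrs ?G (?e i x) - ?F = {?e i w}" using w by simp
        with x closed show False by (auto simp: force_closed_def)
      qed
      moreover have "dominate (Gs i) {s} \<subseteq> ?C"
      proof -
        have "?e i ` nbrs (Gs i) s \<subseteq> nbrs ?G (?e i s)"
          unfolding nb[OF i] by blast
        then show ?thesis
          using s domF by (auto simp: dominate_def)
      qed
      ultimately have "pverts (Gs i) \<subseteq> ?C"
        using final_coloring_subset_closed pd[OF i s(1)] by (metis power_dominating_def)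
      then show ?thesis by blast
    qed
    \<comment> \<open>Were this vertex uncoloured, the first alternative of \<open>whole\<close>
      would colour the entire copy, including it.\<close>
    have "?e i (u i) \<in> ?F" if "i \<in> {1..n}" for i
      using whole[OF that] u[OF that] by blast
    then have "pverts ?G \<subseteq> ?F"
      using whole unfolding pv by (intro UN_least) simp
    then show "power_dominating ?G S"
      using S final_coloring_subset_pverts[OF G S] by (auto simp: power_dominating_def)
  qed
qed

theorem theorem20:
  fixes H :: "'a pair_pre_digraph"
    and n :: nat
    and v :: "nat \<Rightarrow> 'a"
    and Gs :: "nat \<Rightarrow> 'b pair_pre_digraph"
    and u :: "nat \<Rightarrow> 'b"
  assumes "simple_graph H"
    and "bij_betw v {1..n} (pverts H)"
    and "\<And>i. i \<in> {1..n} \<Longrightarrow> simple_graph (Gs i)"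
    and "\<And>i. i \<in> {1..n} \<Longrightarrow> num_pds (Gs i) 1 = card (pverts (Gs i))"
    and "\<And>i. i \<in> {1..n} \<Longrightarrow> u i \<in> pverts (Gs i)"
    and "\<And>i. i \<in> {1..n} \<Longrightarrow> is_path (Gs i) \<Longrightarrow> \<not> path_endpoint (Gs i) (u i)"
  shows "pd_poly (attach H n v Gs u) =
    (\<Prod>i = 1..n. (([:0, 1:] + 1) ^ card (pverts (Gs i)) - 1))"
proof -
  let ?G = "attach H n v Gs u" and ?V = "\<lambda>i. copy_emb v u i ` pverts (Gs i)"
  have inj: "inj_on v {1..n}" using assms(2) by (simp add: bij_betw_def)
  note pd = singleton_power_dominating[OF assms(3,4)]
  \<comment> \<open>Degree at most 1 would make \<open>Gs i\<close> a path with endpoint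
    \<open>u i\<close>; this includes the one-vertex path.\<close>
  have deg: "degree_of (Gs i) (u i) \<ge> 2" if "i \<in> {1..n}" for i
    using leaf_power_dominating_is_path[OF assms(3)[OF that] assms(5)[OF that]]
      pd[OF that that assms(5)[OF that]] assms(6)[OF that] by fastforce
  have pv: "pverts ?G = (\<Union>i\<in>{1..n}. ?V i)"
    using pverts_attach[OF assms(2,5)] .
  have "power_dominating ?G S \<longleftrightarrow> S \<subseteq> (\<Union>i\<in>{1..n}. ?V i) \<and> (\<forall>i\<in>{1..n}. S \<inter> ?V i \<noteq> {})" for S
  proof (cases "S \<subseteq> pverts ?G")
    case True
    then show ?thesis
      using power_dominating_attach_iff[OF assms(1-3) pd assms(5) deg True] pv by simp
  next
    case False
    then show ?thesis using pv by (simp add: power_dominating_def)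
  qed
  then have "pd_poly ?G =
      (\<Sum>S | S \<subseteq> (\<Union>i\<in>{1..n}. ?V i) \<and> (\<forall>i\<in>{1..n}. S \<inter> ?V i \<noteq> {}). [:0, 1:] ^ card S)"
    using pd_poly_eq_sum[OF simple_graph_attach[OF assms(1-3)]] by simp
  also have "\<dots> = (\<Prod>i = 1..n. ([:0, 1:] + 1) ^ card (?V i) - 1)"
  proof (rule sum_power_card_transversals)
    show "finite (?V i)" if "i \<in> {1..n}" for i
      using assms(3)[OF that] by (simp add: simple_graph_def pair_graph_iff)
    show "?V i \<inter> ?V j = {}" if "i \<in> {1..n}" "j \<in> {1..n}" "i \<noteq> j" for i j
      using copy_emb_eq_iff[OF inj that(1,2), where u = u] that(3) by auto
  qed simp
  also have "\<dots> = (\<Prod>i = 1..n. ([:0, 1:] + 1) ^ card (pverts (Gs i)) - 1)"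
  proof (rule prod.cong)
    fix i assume i: "i \<in> {1..n}"
    have "inj_on (copy_emb v u i) (pverts (Gs i))"
      using copy_emb_eq_iff[OF inj i i, where u = u] by (auto simp: inj_on_def)
    then show "([:0, 1:] + 1) ^ card (?V i) - 1 = ([:0, 1:] + 1) ^ card (pverts (Gs i)) - (1 :: int poly)"
      by (simp add: card_image)
  qed simp
  finally show ?thesis .
qed

end
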